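(* Let $(X,d)$ be a metric space supporting a Borel probability measure $\mu$, let $T\colon X\to X$ be an invertible, measure-preserving transformation, and let $f\colon X\to\mathbb{R}$ be a bounded measurable function. Let $(A_N)_{N\in\mathbb{N}}$ be a sequence of real numbers, let $\mathcal{V}=(V_N)_{N\in\mathbb{N}}$ be a sequence of positive real numbers with $V_N\to\infty$ as $N\to\infty$, and let $S$ be a real random variable. Assume that the random variables \[ S_N(x):=\frac{\sum_{n=0}^{N-1}f(T^nx)-A_N}{V_N}\quad\text{on }(X,\mu) \] converge in distribution to $S$ as $N\to\infty$, i.e. for every interval $(a,b)\subseteq\mathbb{R}$ with $\mathbb{P}(S\in\{a,b\})=0$, \[ \lim_{N\to\infty}\mu(\{x\in X : S_N(x)\in(a,b)\})=\mathbb{P}(S\in(a,b)). \] Assume that there exists a measure-preserving, ergodic transformation $U\colon X\to X$ such that the pair $(T,U)$ is hyperbolic and $f$ is $(T,U,\mathcal{V})$-adapted. Then for every pair of Borel measurable subsets $A,B\subseteq X$ and every interval $(a,b)\subseteq\mathbb{R}$ with $\mathbb{P}(S\in\{a,b\})=0$, \[ \lim_{N\to\infty}\mu(\{x\in X : x\in A,\ S_N(x)\in(a,b),\ T^Nx\in B\})=\mu(A)\cdot\mathbb{P}(S\in(a,b))\cdot\mu(B). \]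
   Context: The pair $(T,U)$ is called hyperbolic if for $\mu$-almost every $x\in X$ there exist $C>0$ and $\kappa>0$ such that $d(T^nUx,T^nx)\le Ce^{-\kappa n}$ for every $n\in\mathbb{N}$. A function $f\colon X\to\mathbb{R}$ is called $(T,U,\mathcal{V})$-adapted if for $\mu$-almost every $x\in X$ one has $\sum_{n=0}^{N}|f(T^nUx)-f(T^nx)|=o_x(V_N)$, i.e. the left-hand side divided by $V_N$ tends to $0$ as $N\to\infty$ (at a rate that may depend on $x$). *)

theory Defs
  imports "HOL-Probability.Probability"
begin

definition measure_preserving :: "'a measure \<Rightarrow> ('a \<Rightarrow> 'a) \<Rightarrow> bool" where
  "measure_preserving M T \<longleftrightarrow>
     T \<in> measurable M M \<and> (\<forall>A\<in>sets M. measure M (T -` A \<inter> space M) = measure M A)"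

text \<open>Invertibility is meant in the category of measurable spaces: the inverse map is
  measurable as well. If the map preserves the measure, then so does its inverse.\<close>

definition invertible_transformation :: "'a measure \<Rightarrow> ('a \<Rightarrow> 'a) \<Rightarrow> bool" where
  "invertible_transformation M T \<longleftrightarrow>
     T \<in> measurable M M \<and> bij_betw T (space M) (space M) \<and>
     the_inv_into (space M) T \<in> measurable M M"

definition ergodic :: "'a measure \<Rightarrow> ('a \<Rightarrow> 'a) \<Rightarrow> bool" where
  "ergodic M U \<longleftrightarrow>
     measure_preserving M U \<and>
     (\<forall>A\<in>sets M. U -` A \<inter> space M = A \<longrightarrow> measure M A = 0 \<or> measure M A = 1)"

definition hyperbolic_pair ::
    "'a::metric_space measure \<Rightarrow> ('a \<Rightarrow> 'a) \<Rightarrow> ('a \<Rightarrow> 'a) \<Rightarrow> bool" where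
  "hyperbolic_pair M T U \<longleftrightarrow>
     (AE x in M. \<exists>C>0. \<exists>\<kappa>>0. \<forall>n::nat.
        dist ((T ^^ n) (U x)) ((T ^^ n) x) \<le> C * exp (- \<kappa> * real n))"

definition adapted ::
    "'a measure \<Rightarrow> ('a \<Rightarrow> 'a) \<Rightarrow> ('a \<Rightarrow> 'a) \<Rightarrow> (nat \<Rightarrow> real) \<Rightarrow> ('a \<Rightarrow> real) \<Rightarrow> bool" where
  "adapted M T U V f \<longleftrightarrow>
     (AE x in M. (\<lambda>N. (\<Sum>n=0..N. \<bar>f ((T ^^ n) (U x)) - f ((T ^^ n) x)\<bar>) / V N) \<longlonglongrightarrow> 0)"

definition normalized_sum ::
    "('a \<Rightarrow> 'a) \<Rightarrow> ('a \<Rightarrow> real) \<Rightarrow> (nat \<Rightarrow> real) \<Rightarrow> (nat \<Rightarrow> real) \<Rightarrow> nat \<Rightarrow> 'a \<Rightarrow> real" where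
  "normalized_sum T f A V N x = ((\<Sum>n<N. f ((T ^^ n) x)) - A N) / V N"

text \<open>Convergence in distribution of random variables \<open>Y N\<close> on \<open>M\<close> to a random variable
  \<open>S\<close> that may live on a different probability space \<open>P\<close>, tested on bounded open
  intervals whose endpoints are not atoms of the limit law. For \<open>a \<ge> b\<close> the
  interval is empty and the condition holds trivially.\<close>

definition converges_in_distribution ::
    "'a measure \<Rightarrow> (nat \<Rightarrow> 'a \<Rightarrow> real) \<Rightarrow> 'b measure \<Rightarrow> ('b \<Rightarrow> real) \<Rightarrow> bool" where
  "converges_in_distribution M Y P S \<longleftrightarrow>
     (\<forall>a b. measure P {\<omega> \<in> space P. S \<omega> \<in> {a, b}} = 0 \<longrightarrow>
        (\<lambda>N. measure M {x \<in> space M. Y N x \<in> {a<..<b}})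
          \<longlonglongrightarrow> measure P {\<omega> \<in> space P. S \<omega> \<in> {a<..<b}})"

end

theory Submission
  imports Defs
begin

text \<open>Call a sequence of sets \<open>E N\<close> asymptotically \<open>U\<close>-invariant if the measure of the symmetric
  difference of \<open>E N\<close> and its preimage under \<open>U\<close> tends to \<open>0\<close>. If \<open>U\<close> is ergodic, such a sequence
  decorrelates from every fixed set, by the mean ergodic theorem. Hyperbolicity makes the sets
  \<open>T\<^sup>-\<^sup>N B\<close> asymptotically \<open>U\<close>-invariant, hence \<open>T\<close> is mixing and in particular ergodic. The events
  \<open>S\<^sub>N \<in> (a, b)\<close> are asymptotically invariant under \<open>T\<close>, because \<open>f\<close> is bounded, and under \<open>U\<close>,
  because \<open>f\<close> is adapted. The first property, used with \<open>T\<close>, decorrelates \<open>S\<^sub>N \<in> (a, b)\<close> from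
  \<open>T\<^sup>-\<^sup>N B\<close>; the second, used with \<open>U\<close>, decorrelates their intersection from \<open>A\<close>.\<close>

section \<open>Maps preserving a probability measure\<close>

lemma measure_preserving_distr:
  assumes "prob_space M" "measure_preserving M T"
  shows "distr M M T = M"
proof (rule measure_eqI)
  interpret prob_space M by fact
  have T [measurable]: "T \<in> measurable M M"
    using assms by (simp add: measure_preserving_def)
  fix A assume "A \<in> sets (distr M M T)"
  then have A: "A \<in> sets M" by simp
  then have "emeasure (distr M M T) A = emeasure M (T -` A \<inter> space M)"
    by (simp add: emeasure_distr)
  also have "\<dots> = emeasure M A"
    using assms(2) A by (simp add: measure_preserving_def emeasure_eq_measure)
  finally show "emeasure (distr M M T) A = emeasure M A" .
qed simp

lemma measure_preserving_integral:
  fixes g :: "'a \<Rightarrow> real"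
  assumes "prob_space M" "measure_preserving M T" "g \<in> borel_measurable M"
  shows "(\<integral>x. g (T x) \<partial>M) = (\<integral>x. g x \<partial>M)"
proof -
  have "T \<in> measurable M M" using assms by (simp add: measure_preserving_def)
  then have "(\<integral>x. g (T x) \<partial>M) = (\<integral>x. g x \<partial>distr M M T)"
    using assms(3) by (simp add: integral_distr)
  then show ?thesis using measure_preserving_distr[OF assms(1,2)] by simp
qed

lemma measure_preserving_measure:
  assumes "measure_preserving M T" "A \<in> sets M"
  shows "measure M {x \<in> space M. T x \<in> A} = measure M A"
proof -
  have "{x \<in> space M. T x \<in> A} = T -` A \<inter> space M" by auto
  then show ?thesis using assms by (simp add: measure_preserving_def)
qed

lemma measure_preserving_funpow:
  assumes "measure_preserving M T"
  shows "measure_preserving M (T ^^ n)"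
proof (induction n)
  case 0
  then show ?case
    by (auto simp: measure_preserving_def id_def dest: sets.sets_into_space intro!: arg_cong[of _ _ "measure M"])
next
  case (Suc n)
  have T: "T \<in> measurable M M" and Tn: "T ^^ n \<in> measurable M M"
    using assms Suc by (auto simp: measure_preserving_def)
  have "measure M ((T ^^ Suc n) -` A \<inter> space M) = measure M A" if A: "A \<in> sets M" for A
  proof -
    have "T -` A \<inter> space M \<in> sets M" using T A by (rule measurable_sets)
    then have "measure M ((T ^^ n) -` (T -` A \<inter> space M) \<inter> space M) = measure M A"
      using Suc assms A unfolding measure_preserving_def by metis
    moreover have "(T ^^ n) -` (T -` A \<inter> space M) \<inter> space M = (T ^^ Suc n) -` A \<inter> space M"
      using measurable_space[OF Tn] by auto
    ultimately show ?thesis by simp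
  qed
  then show ?case
    using measurable_comp[OF Tn T] unfolding measure_preserving_def funpow.simps by blast
qed

section \<open>Ergodic theorem for bounded functions\<close>

text \<open>The partial maxima satisfy
  \<open>F (n + 1) = max 0 (g + F n \<circ> U)\<close>, so the set where they are unbounded is invariant. If it had
  full measure, the nonnegative numbers \<open>\<integral>(F (n + 1) - F n \<circ> U)\<close> would tend to \<open>\<integral>g < 0\<close>.\<close>

lemma ergodic_partial_sums_bounded_above:
  fixes g :: "'a \<Rightarrow> real"
  assumes M: "prob_space M" and erg: "ergodic M U"
    and g [measurable]: "g \<in> borel_measurable M"
    and K: "\<And>x. \<bar>g x\<bar> \<le> K"
    and neg: "(\<integral>x. g x \<partial>M) < 0"
  shows "AE x in M. \<exists>c. \<forall>n. (\<Sum>j<n. g ((U ^^ j) x)) \<le> c"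
proof -
  interpret prob_space M by fact
  have mp: "measure_preserving M U" and U [measurable]: "U \<in> measurable M M"
    using erg by (auto simp: ergodic_def measure_preserving_def)
  \<comment> \<open>\<open>F n x\<close> is the largest of the partial sums of lengths
    \<open>0, ..., n\<close> along the \<open>U\<close>-orbit of \<open>x\<close>, the empty sum
    included.\<close>
  define F where "F = rec_nat (\<lambda>x. 0) (\<lambda>n Fn x. max 0 (g x + Fn (U x)))"
  have F0: "F 0 x = 0" and FS: "F (Suc n) x = max 0 (g x + F n (U x))" for n x
    by (auto simp: F_def)
  have sum_le: "(\<Sum>j<n. g ((U ^^ j) x)) \<le> F n x" for n x
  proof (induction n arbitrary: x)
    case (Suc n)
    have "(\<Sum>j<Suc n. g ((U ^^ j) x)) = g x + (\<Sum>j<n. g ((U ^^ j) (U x)))"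
      unfolding sum.lessThan_Suc_shift by (simp add: funpow_swap1)
    also have "\<dots> \<le> F (Suc n) x" using Suc[of "U x"] by (simp add: FS)
    finally show ?case .
  qed (simp add: F0)
  have F_nonneg: "0 \<le> F n x" for n x by (cases n) (auto simp: F0 FS)
  have F_Suc: "F n x \<le> F (Suc n) x" for n x
  proof (induction n arbitrary: x)
    case (Suc n)
    show ?case using Suc[of "U x"] unfolding FS[of "Suc n"] FS[of n] by linarith
  qed (simp add: F0 F_nonneg)
  have F_mono: "m \<le> n \<Longrightarrow> F m x \<le> F n x" for m n x
    by (rule lift_Suc_mono_le[of "\<lambda>n. F n x"]) (auto simp: F_Suc)
  have F_meas [measurable]: "F n \<in> borel_measurable M" for n
  proof (induction n)
    case 0
    have "F 0 = (\<lambda>x. 0)" by (auto simp: F0)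
    then show ?case by simp
  next
    case (Suc n)
    note Suc [measurable]
    have "F (Suc n) = (\<lambda>x. max 0 (g x + F n (U x)))" by (auto simp: FS)
    then show ?case by simp
  qed
  have F_bd: "F n x \<le> real n * K" for n x
  proof (induction n arbitrary: x)
    case (Suc n)
    have "0 \<le> K" using K[of x] by linarith
    then have "0 \<le> real (Suc n) * K" by simp
    moreover have "g x + F n (U x) \<le> real (Suc n) * K"
      using Suc[of "U x"] K[of x] by (simp add: algebra_simps)
    ultimately show ?case by (simp add: FS)
  qed (simp add: F0)
  have F_int [simp]: "integrable M (F n)" "integrable M (\<lambda>x. F n (U x))" for n
    by (rule integrable_const_bound[where B = "real n * K"]; use F_bd F_nonneg in auto)+
  define A where "A = {x \<in> space M. \<forall>c::nat. \<exists>n. real c < F n x}"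
  have A [measurable]: "A \<in> sets M" unfolding A_def by measurable
  \<comment> \<open>The recursion changes the value by at most \<open>K\<close> and the index by
    one, so unboundedness at \<open>x\<close> and at \<open>U x\<close> are equivalent.\<close>
  have UA: "U x \<in> A \<longleftrightarrow> x \<in> A" if x: "x \<in> space M" for x
  proof
    assume "U x \<in> A"
    show "x \<in> A" unfolding A_def
    proof (safe intro!: x)
      fix c :: nat
      obtain b :: nat where b: "real c + K \<le> real b" by (meson real_arch_simple)
      obtain n where "real b < F n (U x)" using \<open>U x \<in> A\<close> by (auto simp: A_def)
      then have "real c < F (Suc n) x" using b K[of x] by (simp add: FS)
      then show "\<exists>n. real c < F n x" ..
    qed
  next
    have Ux: "U x \<in> space M" using U x by (rule measurable_space)
    assume "x \<in> A"
    show "U x \<in> A" unfolding A_def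
    proof (safe intro!: Ux)
      fix c :: nat
      obtain b :: nat where b: "real c + K \<le> real b" by (meson real_arch_simple)
      have K0: "0 \<le> K" using K[of x] by linarith
      obtain n where n: "real b < F n x" using \<open>x \<in> A\<close> by (auto simp: A_def)
      \<comment> \<open>The index \<open>n\<close> is not 0, because \<open>F 0\<close> vanishes
        while \<open>F n x\<close> exceeds \<open>b\<close>.\<close>
      then obtain m where "n = Suc m" by (cases n) (auto simp: F0)
      then have "real c < F m (U x)"
        using n b K[of x] K0 by (simp add: FS max_def split: if_splits)
      then show "\<exists>n. real c < F n (U x)" ..
    qed
  qed
  have "U -` A \<inter> space M = A"
    using UA sets.sets_into_space[OF A] by auto
  then have "prob A = 0 \<or> prob A = 1" using erg A by (auto simp: ergodic_def)
  moreover have "prob A \<noteq> 1"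
  proof
    assume "prob A = 1"
    then have AE_A: "AE x in M. x \<in> A" by (simp add: prob_eq_1)
    have "(\<lambda>n. \<integral>x. F (Suc n) x - F n (U x) \<partial>M) \<longlonglongrightarrow> (\<integral>x. g x \<partial>M)"
    proof (rule integral_dominated_convergence[where w = "\<lambda>_. K"])
      show "AE x in M. (\<lambda>n. F (Suc n) x - F n (U x)) \<longlonglongrightarrow> g x"
        using AE_A
      proof eventually_elim
        case (elim x)
        then have "U x \<in> A" using UA[of x] by (auto simp: A_def)
        obtain b :: nat where b: "K \<le> real b" by (meson real_arch_simple)
        obtain m where m: "real b < F m (U x)" using \<open>U x \<in> A\<close> by (auto simp: A_def)
        \<comment> \<open>Once \<open>F m (U x)\<close> exceeds \<open>K\<close>, the maximum with 0
          in the recursion is attained by the other term, so the difference is exactly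
          \<open>g x\<close> from then on.\<close>
        have "F (Suc n) x - F n (U x) = g x" if "n \<ge> m" for n
          using F_mono[OF that, of "U x"] m b K[of x] by (simp add: FS)
        then have "eventually (\<lambda>n. F (Suc n) x - F n (U x) = g x) sequentially"
          by (auto simp: eventually_sequentially)
        then show ?case by (rule tendsto_eventually)
      qed
      fix n
      \<comment> \<open>The map \<open>max 0\<close> is 1-Lipschitz and fixes the nonnegative number
        \<open>F n (U x)\<close>, so the difference is at most
        \<open>\<bar>g x\<bar>\<close>.\<close>
      show "AE x in M. norm (F (Suc n) x - F n (U x)) \<le> K"
      proof (rule AE_I2)
        fix x
        show "norm (F (Suc n) x - F n (U x)) \<le> K"
          using K[of x] F_nonneg[of n "U x"] unfolding FS real_norm_def by linarith
      qed
    qed auto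
    \<comment> \<open>Invariance turns the integral of \<open>F n\<close> composed with
      \<open>U\<close> into that of \<open>F n\<close>, and \<open>F\<close> increases in
      \<open>n\<close>.\<close>
    moreover have "0 \<le> (\<integral>x. F (Suc n) x - F n (U x) \<partial>M)" for n
    proof -
      have "(\<integral>x. F n x \<partial>M) \<le> (\<integral>x. F (Suc n) x \<partial>M)"
        by (rule integral_mono) (auto simp: F_Suc)
      then show ?thesis
        by (simp add: measure_preserving_integral[OF M mp])
    qed
    ultimately have "0 \<le> (\<integral>x. g x \<partial>M)" by (intro LIMSEQ_le_const) auto
    then show False using neg by simp
  qed
  ultimately have "prob A = 0" by simp
  then have "AE x in M. x \<notin> A" using A by (simp add: prob_eq_0)
  then show ?thesis
    using AE_space
  proof eventually_elim
    case (elim x)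
    then obtain c :: nat where "\<And>n. F n x \<le> real c" by (auto simp: A_def not_less)
    then show ?case by (intro exI[of _ "real c"] allI order_trans[OF sum_le])
  qed
qed

text \<open>Subtracting slightly more than the mean from \<open>g\<close> makes the integral
  negative, so the shifted partial sums are bounded above almost everywhere, and this bound becomes
  negligible after division by \<open>n\<close>.\<close>

lemma ergodic_upper_average:
  fixes g :: "'a \<Rightarrow> real"
  assumes M: "prob_space M" and erg: "ergodic M U"
    and g [measurable]: "g \<in> borel_measurable M"
    and K: "\<And>x. \<bar>g x\<bar> \<le> K"
  shows "AE x in M. \<forall>e>0. eventually
    (\<lambda>n. (\<Sum>j<n. g ((U ^^ j) x)) / real n < (\<integral>x. g x \<partial>M) + e) sequentially"
proof -
  interpret prob_space M by fact
  define I where "I = (\<integral>x. g x \<partial>M)"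
  have gi: "integrable M g" by (rule integrable_const_bound[where B = K]) (use K in auto)
  \<comment> \<open>Margins of the form \<open>1 / (k + 1)\<close> produce only countably many null
    sets, so one exceptional set serves every \<open>e\<close>.\<close>
  have "AE x in M. \<forall>k::nat. \<exists>c. \<forall>n. (\<Sum>j<n. g ((U ^^ j) x) - I - 1 / real (Suc k)) \<le> c"
    unfolding AE_all_countable
  proof
    fix k :: nat
    show "AE x in M. \<exists>c. \<forall>n. (\<Sum>j<n. g ((U ^^ j) x) - I - 1 / real (Suc k)) \<le> c"
    proof (rule ergodic_partial_sums_bounded_above[OF M erg])
      show "\<bar>g x - I - 1 / real (Suc k)\<bar> \<le> K + \<bar>I\<bar> + 1 / real (Suc k)" for x
      proof -
        have "0 \<le> 1 / real (Suc k)" by simp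
        then show ?thesis using K[of x] by linarith
      qed
      show "(\<integral>x. g x - I - 1 / real (Suc k) \<partial>M) < 0"
        using gi by (simp add: I_def prob_space)
    qed measurable
  qed
  then show ?thesis
  proof eventually_elim
    case (elim x)
    show ?case
    proof (intro allI impI)
      fix e :: real assume "0 < e"
      then obtain k :: nat where k: "1 / real (Suc k) < e / 2"
        using nat_approx_posE[of "e / 2"] by auto
      obtain c where c: "\<And>n. (\<Sum>j<n. g ((U ^^ j) x) - I - 1 / real (Suc k)) \<le> c"
        using elim by blast
      have "(\<lambda>n. c / real n) \<longlonglongrightarrow> 0" by (rule lim_const_over_n)
      then have "eventually (\<lambda>n. c / real n < e / 2) sequentially"
        using \<open>0 < e\<close> by (auto dest: order_tendstoD(2)[of _ _ _ "e / 2"])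
      then show "eventually (\<lambda>n. (\<Sum>j<n. g ((U ^^ j) x)) / real n < (\<integral>x. g x \<partial>M) + e) sequentially"
        using eventually_gt_at_top[of 0]
      proof eventually_elim
        case (elim n)
        have "(\<Sum>j<n. g ((U ^^ j) x)) \<le> c + real n * (I + 1 / real (Suc k))"
          using c[of n] by (simp add: sum_subtractf algebra_simps)
        then have "(\<Sum>j<n. g ((U ^^ j) x)) / real n \<le> c / real n + (I + 1 / real (Suc k))"
          using elim(2) by (simp add: pos_divide_le_eq distrib_right algebra_simps)
        then show ?case using elim(1) k unfolding I_def by linarith
      qed
    qed
  qed
qed

text \<open>The one-sided estimate for \<open>g\<close> and for \<open>- g\<close> gives convergence
  of the averages almost everywhere; boundedness upgrades it to L1 by dominated convergence.\<close>

lemma ergodic_mean_L1: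
  fixes g :: "'a \<Rightarrow> real"
  assumes M: "prob_space M" and erg: "ergodic M U"
    and g [measurable]: "g \<in> borel_measurable M"
    and K: "\<And>x. \<bar>g x\<bar> \<le> K"
  shows "(\<lambda>n. \<integral>x. \<bar>(\<Sum>j<n. g ((U ^^ j) x)) / real n - (\<integral>x. g x \<partial>M)\<bar> \<partial>M) \<longlonglongrightarrow> 0"
proof -
  interpret prob_space M by fact
  define I where "I = (\<integral>x. g x \<partial>M)"
  have U [measurable]: "U ^^ n \<in> measurable M M" for n
    using erg measure_preserving_funpow[of M U n] by (auto simp: ergodic_def measure_preserving_def)
  have K0: "0 \<le> K" using K[of undefined] by linarith
  have upper: "AE x in M. \<forall>e>0. eventually
      (\<lambda>n. (\<Sum>j<n. g ((U ^^ j) x)) / real n < I + e) sequentially"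
    using ergodic_upper_average[OF M erg g K] by (simp add: I_def)
  have lower: "AE x in M. \<forall>e>0. eventually
      (\<lambda>n. (\<Sum>j<n. - g ((U ^^ j) x)) / real n < - I + e) sequentially"
    using ergodic_upper_average[OF M erg borel_measurable_uminus[OF g], of K] K by (simp add: I_def)
  have ae: "AE x in M. (\<lambda>n. (\<Sum>j<n. g ((U ^^ j) x)) / real n) \<longlonglongrightarrow> I"
    using upper lower
  proof eventually_elim
    case (elim x)
    show ?case
    proof (rule order_tendstoI)
      fix a assume "a < I"
      then have "eventually (\<lambda>n. (\<Sum>j<n. - g ((U ^^ j) x)) / real n < - I + (I - a)) sequentially"
        using elim by (auto dest!: spec[of _ "I - a"])
      then show "eventually (\<lambda>n. a < (\<Sum>j<n. g ((U ^^ j) x)) / real n) sequentially"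
        by eventually_elim (simp add: sum_negf)
    next
      fix a assume "I < a"
      then show "eventually (\<lambda>n. (\<Sum>j<n. g ((U ^^ j) x)) / real n < a) sequentially"
        using elim by (auto dest!: spec[of _ "a - I"])
    qed
  qed
  have "(\<lambda>n. \<integral>x. \<bar>(\<Sum>j<n. g ((U ^^ j) x)) / real n - I\<bar> \<partial>M) \<longlonglongrightarrow> (\<integral>x. 0 \<partial>M)"
  proof (rule integral_dominated_convergence[where w = "\<lambda>_. K + \<bar>I\<bar>"])
    show "AE x in M. (\<lambda>n. \<bar>(\<Sum>j<n. g ((U ^^ j) x)) / real n - I\<bar>) \<longlonglongrightarrow> 0"
      using ae by eventually_elim (simp add: LIM_zero tendsto_rabs_zero)
    fix n
    show "AE x in M. norm \<bar>(\<Sum>j<n. g ((U ^^ j) x)) / real n - I\<bar> \<le> K + \<bar>I\<bar>"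
    proof (rule AE_I2)
      fix x
      have "\<bar>\<Sum>j<n. g ((U ^^ j) x)\<bar> \<le> (\<Sum>j<n. K)"
        by (rule order_trans[OF sum_abs], rule sum_mono, rule K)
      \<comment> \<open>For \<open>n = 0\<close> the quotient is 0 by the convention for division,
        and the bound reads \<open>0 \<le> K\<close>.\<close>
      then have "\<bar>(\<Sum>j<n. g ((U ^^ j) x)) / real n\<bar> \<le> K"
        using K0 by (cases "n = 0") (auto simp: field_simps)
      then show "norm \<bar>(\<Sum>j<n. g ((U ^^ j) x)) / real n - I\<bar> \<le> K + \<bar>I\<bar>"
        unfolding real_norm_def by linarith
    qed
  qed auto
  then show ?thesis by (simp add: I_def)
qed

section \<open>Asymptotically invariant sequences of sets\<close>

definition asymptotically_invariant :: "'a measure \<Rightarrow> ('a \<Rightarrow> 'a) \<Rightarrow> (nat \<Rightarrow> 'a set) \<Rightarrow> bool" where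
  "asymptotically_invariant M U E \<longleftrightarrow> (\<forall>N. E N \<in> sets M) \<and>
     (\<lambda>N. measure M {x \<in> space M. (U x \<in> E N) \<noteq> (x \<in> E N)}) \<longlonglongrightarrow> 0"

lemma (in prob_space) measure_Int_change:
  assumes A [measurable]: "A \<in> sets M" and E [measurable]: "E \<in> sets M" "E' \<in> sets M"
  shows "\<bar>prob (A \<inter> E) - prob (A \<inter> E')\<bar> \<le> prob {x \<in> space M. (x \<in> E) \<noteq> (x \<in> E')}"
proof -
  let ?D = "{x \<in> space M. (x \<in> E) \<noteq> (x \<in> E')}"
  have D [measurable]: "?D \<in> sets M" by measurable
  have sub: "A \<subseteq> space M" "E \<subseteq> space M" "E' \<subseteq> space M"
    using A E by (blast dest: sets.sets_into_space)+
  have "prob (A \<inter> E) \<le> prob ((A \<inter> E') \<union> ?D)" "prob (A \<inter> E') \<le> prob ((A \<inter> E) \<union> ?D)"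
    using sub by (auto intro!: finite_measure_mono)
  moreover have "prob ((A \<inter> E') \<union> ?D) \<le> prob (A \<inter> E') + prob ?D"
    "prob ((A \<inter> E) \<union> ?D) \<le> prob (A \<inter> E) + prob ?D"
    by (auto intro!: measure_Un_le)
  ultimately show ?thesis by linarith
qed

text \<open>Replacing \<open>A\<close> by its preimage \<open>U\<^sup>-\<^sup>j A\<close> costs at most \<open>j\<close> times the defect of invariance, and the average of
  the indicators of these preimages over \<open>j\<close> is close to the constant \<open>measure M A\<close>.\<close>

lemma asymptotically_invariant_decorrelates:
  assumes M: "prob_space M" and erg: "ergodic M U"
    and inv: "asymptotically_invariant M U E" and A [measurable]: "A \<in> sets M"
  shows "(\<lambda>N. measure M (A \<inter> E N) - measure M A * measure M (E N)) \<longlonglongrightarrow> 0"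
proof -
  interpret prob_space M by fact
  have mp: "measure_preserving M U" and U1 [measurable]: "U \<in> measurable M M"
    using erg by (auto simp: ergodic_def measure_preserving_def)
  have mpn: "measure_preserving M (U ^^ n)" for n by (rule measure_preserving_funpow[OF mp])
  then have U [measurable]: "U ^^ n \<in> measurable M M" for n by (auto simp: measure_preserving_def)
  have E [measurable]: "E N \<in> sets M" for N using inv by (auto simp: asymptotically_invariant_def)
  define d where "d N = prob {x \<in> space M. (U x \<in> E N) \<noteq> (x \<in> E N)}" for N
  have d0: "d \<longlonglongrightarrow> 0" using inv by (simp add: asymptotically_invariant_def d_def[abs_def])
  have dn: "0 \<le> d N" for N by (simp add: d_def)
  \<comment> \<open>\<open>W J\<close> averages the indicators of the preimages of \<open>A\<close>
    under the first \<open>J\<close> iterates, starting with the identity; \<open>e J\<close> is its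
    L1 distance from the constant \<open>prob A\<close>.\<close>
  define W where "W J x = (\<Sum>j<J. indicator A ((U ^^ j) x) :: real) / real J" for J x
  define e where "e J = (\<integral>x. \<bar>W J x - prob A\<bar> \<partial>M)" for J
  have e0: "e \<longlonglongrightarrow> 0"
    using ergodic_mean_L1[OF M erg, of "indicator A" 1] unfolding e_def[abs_def] W_def
    by (simp add: abs_indicator indicator_le_1)
  \<comment> \<open>A change of membership between times 0 and \<open>j + 1\<close> requires one
    between 0 and \<open>j\<close> or one in the last step, and by invariance the latter has
    probability \<open>d N\<close>.\<close>
  have iter: "prob {x \<in> space M. ((U ^^ j) x \<in> E N) \<noteq> (x \<in> E N)} \<le> real j * d N" for j N
  proof (induction j)
    case (Suc j)
    let ?D = "\<lambda>j. {x \<in> space M. ((U ^^ j) x \<in> E N) \<noteq> (x \<in> E N)}"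
    let ?S = "{x \<in> space M. (U x \<in> E N) \<noteq> (x \<in> E N)}"
    have "prob {x \<in> space M. (U ^^ j) x \<in> ?S} = d N"
      unfolding d_def by (rule measure_preserving_measure[OF mpn]) measurable
    moreover have "prob (?D (Suc j)) \<le> prob (?D j \<union> {x \<in> space M. (U ^^ j) x \<in> ?S})"
      using measurable_space[OF U] by (intro finite_measure_mono) auto
    moreover have "\<dots> \<le> prob (?D j) + prob {x \<in> space M. (U ^^ j) x \<in> ?S}"
      by (intro measure_Un_le) measurable
    ultimately show ?case using Suc by (simp add: algebra_simps)
  qed simp
  \<comment> \<open>Pulling back \<open>A \<inter> E N\<close> by \<open>U ^^ j\<close> keeps its
    measure; replacing the pulled back \<open>E N\<close> by \<open>E N\<close> costs at most
    \<open>j * d N\<close>.\<close>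
  have shift: "\<bar>prob (A \<inter> E N) - prob ({x \<in> space M. (U ^^ j) x \<in> A} \<inter> E N)\<bar> \<le> real j * d N" for j N
  proof -
    have "prob (A \<inter> E N) = prob {x \<in> space M. (U ^^ j) x \<in> A \<inter> E N}"
      by (rule measure_preserving_measure[OF mpn, symmetric]) measurable
    also have "{x \<in> space M. (U ^^ j) x \<in> A \<inter> E N}
        = {x \<in> space M. (U ^^ j) x \<in> A} \<inter> {x \<in> space M. (U ^^ j) x \<in> E N}" by auto
    finally have "prob (A \<inter> E N) = prob \<dots>" .
    moreover have "{x \<in> space M. (x \<in> {x \<in> space M. (U ^^ j) x \<in> E N}) \<noteq> (x \<in> E N)}
        = {x \<in> space M. ((U ^^ j) x \<in> E N) \<noteq> (x \<in> E N)}" by auto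
    ultimately show ?thesis
      using measure_Int_change[of "{x \<in> space M. (U ^^ j) x \<in> A}"
          "{x \<in> space M. (U ^^ j) x \<in> E N}" "E N"] iter[of j N]
      by (simp del: mem_Collect_eq)
  qed
  have W_int: "integrable M (\<lambda>x. W J x)" for J
  proof -
    have "integrable M (\<lambda>x. indicator A ((U ^^ j) x) :: real)" for j
      by (rule integrable_const_bound[where B = 1]) (auto simp: indicator_def)
    then show ?thesis
      unfolding W_def by (intro integrable_divide Bochner_Integration.integrable_sum)
  qed
  have avg: "\<bar>prob (A \<inter> E N) - (\<integral>x. indicator (E N) x * W J x \<partial>M)\<bar> \<le> real J * d N"
    if "0 < J" for J N
  proof -
    let ?p = "\<lambda>j. prob ({x \<in> space M. (U ^^ j) x \<in> A} \<inter> E N)"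
    have int1: "(\<integral>x. indicator (E N) x * indicator A ((U ^^ j) x) \<partial>M) = ?p j"
      and int2: "integrable M (\<lambda>x. indicator (E N) x * indicator A ((U ^^ j) x) :: real)" for j
    proof -
      have "(\<integral>x. indicator (E N) x * indicator A ((U ^^ j) x) \<partial>M)
          = (\<integral>x. indicator ({x \<in> space M. (U ^^ j) x \<in> A} \<inter> E N) x \<partial>M :: real)"
        by (rule Bochner_Integration.integral_cong) (auto simp: indicator_def)
      then show "(\<integral>x. indicator (E N) x * indicator A ((U ^^ j) x) \<partial>M) = ?p j"
        by (simp add: Int_assoc)
      show "integrable M (\<lambda>x. indicator (E N) x * indicator A ((U ^^ j) x) :: real)"
        by (rule integrable_const_bound[where B = 1]) (auto simp: indicator_def)
    qed
    have "(\<integral>x. indicator (E N) x * W J x \<partial>M) = (\<Sum>j<J. ?p j) / real J"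
      unfolding W_def times_divide_eq_right sum_distrib_left integral_divide_zero
      by (subst Bochner_Integration.integral_sum[OF int2]) (simp only: int1)
    moreover have "\<bar>real J * prob (A \<inter> E N) - (\<Sum>j<J. ?p j)\<bar> \<le> real J * (real J * d N)"
    proof -
      have "real J * prob (A \<inter> E N) - (\<Sum>j<J. ?p j) = (\<Sum>j<J. prob (A \<inter> E N) - ?p j)"
        by (simp add: sum_subtractf)
      also have "\<bar>\<dots>\<bar> \<le> (\<Sum>j<J. \<bar>prob (A \<inter> E N) - ?p j\<bar>)" by (rule sum_abs)
      also have "\<dots> \<le> (\<Sum>j<J. real J * d N)"
        by (rule sum_mono, rule order_trans[OF shift]) (auto intro!: mult_right_mono dn)
      finally show ?thesis by simp
    qed
    moreover have "prob (A \<inter> E N) - (\<Sum>j<J. ?p j) / real J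
        = (real J * prob (A \<inter> E N) - (\<Sum>j<J. ?p j)) / real J"
      using that by (simp add: field_simps)
    ultimately show ?thesis
      using that by (simp add: abs_divide divide_le_eq mult.commute mult.left_commute)
  qed
  \<comment> \<open>The indicator of \<open>E N\<close> is at most 1, so the error is bounded by
    \<open>e J\<close> uniformly in \<open>N\<close>.\<close>
  have mean: "\<bar>(\<integral>x. indicator (E N) x * W J x \<partial>M) - prob A * prob (E N)\<bar> \<le> e J" for J N
  proof -
    have i1: "integrable M (\<lambda>x. indicator (E N) x * W J x)"
      using integrable_real_mult_indicator[OF E W_int, of J N] by (simp add: mult.commute)
    have i3: "integrable M (indicator (E N) :: 'a \<Rightarrow> real)"
      by (rule integrable_const_bound[where B = 1]) (auto simp: indicator_def)
    have i2: "integrable M (\<lambda>x. \<bar>W J x - prob A\<bar>)" using W_int by simp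
    have "(\<integral>x. indicator (E N) x * W J x \<partial>M) - prob A * prob (E N)
        = (\<integral>x. indicator (E N) x * W J x - prob A * indicator (E N) x \<partial>M)"
      using i1 i3 by (subst Bochner_Integration.integral_diff) auto
    also have "\<bar>\<dots>\<bar> \<le> (\<integral>x. \<bar>indicator (E N) x * W J x - prob A * indicator (E N) x\<bar> \<partial>M)"
      by (rule integral_abs_bound)
    also have "\<dots> \<le> e J"
      unfolding e_def
      by (intro integral_mono integrable_abs Bochner_Integration.integrable_diff
          integrable_mult_right i1 i3 W_int finite_measure.integrable_const) (auto simp: indicator_def split: if_splits intro: finite_measure_axioms)
    finally show ?thesis .
  qed
  have bound: "\<bar>prob (A \<inter> E N) - prob A * prob (E N)\<bar> \<le> real J * d N + e J" if "0 < J" for J N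
    using avg[OF that, of N] mean[of N J] by linarith
  show ?thesis
  proof (rule LIMSEQ_I)
    fix r :: real assume r: "0 < r"
    \<comment> \<open>The order of choices matters: \<open>J\<close> is fixed first to make
      \<open>e J\<close> small, and only then does \<open>N\<close> tend to infinity.\<close>
    have "eventually (\<lambda>J. e J < r / 2 \<and> 0 < J) sequentially"
      using order_tendstoD(2)[OF e0, of "r / 2"] r eventually_gt_at_top[of 0]
      by (auto intro: eventually_conj)
    then obtain J where J: "e J < r / 2" "0 < J" by (auto simp: eventually_sequentially)
    have "(\<lambda>N. real J * d N) \<longlonglongrightarrow> real J * 0" by (intro tendsto_intros d0)
    then have "eventually (\<lambda>N. real J * d N < r / 2) sequentially"
      using r by (intro order_tendstoD(2)[of _ "real J * 0"]) auto
    then obtain N0 where "\<forall>N\<ge>N0. real J * d N < r / 2" by (auto simp: eventually_sequentially)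
    then show "\<exists>N0. \<forall>N\<ge>N0. norm (prob (A \<inter> E N) - prob A * prob (E N) - 0) < r"
      using bound[OF J(2)] J(1) by (intro exI[of _ N0]) (fastforce intro: le_less_trans)
  qed
qed

section \<open>Convergence in measure and covers by small sets\<close>

text \<open>At almost every point the indicators of the exceptional sets are eventually 0, so
  dominated convergence applies to them.\<close>

lemma (in prob_space) tendsto_AE_imp_measure:
  fixes D :: "nat \<Rightarrow> 'a \<Rightarrow> real"
  assumes [measurable]: "\<And>N. D N \<in> borel_measurable M"
    and lim: "AE x in M. (\<lambda>N. D N x) \<longlonglongrightarrow> 0" and "0 < \<delta>"
  shows "(\<lambda>N. prob {x \<in> space M. \<delta> \<le> \<bar>D N x\<bar>}) \<longlonglongrightarrow> 0"
proof -
  have "(\<lambda>N. \<integral>x. indicator {x \<in> space M. \<delta> \<le> \<bar>D N x\<bar>} x \<partial>M) \<longlonglongrightarrow> (\<integral>x. 0 \<partial>M :: real)"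
  proof (rule integral_dominated_convergence[where w = "\<lambda>_. 1"])
    show "AE x in M. (\<lambda>N. indicator {x \<in> space M. \<delta> \<le> \<bar>D N x\<bar>} x :: real) \<longlonglongrightarrow> 0"
      using lim
    proof eventually_elim
      case (elim x)
      have "eventually (\<lambda>N. \<bar>D N x\<bar> < \<delta>) sequentially"
        using tendsto_rabs_zero[OF elim] \<open>0 < \<delta>\<close> by (rule order_tendstoD)
      then have "eventually (\<lambda>N. indicator {x \<in> space M. \<delta> \<le> \<bar>D N x\<bar>} x = (0 :: real)) sequentially"
        by eventually_elim auto
      then show ?case by (rule tendsto_eventually)
    qed
  qed (auto simp: indicator_def)
  then show ?thesis by simp
qed

text \<open>The approximations below cover a set by a part that vanishes in the limit and a part
  that is merely small; both may depend on \<open>\<epsilon>\<close>.\<close>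

lemma (in prob_space) measure_tendsto_0_if_small_cover:
  assumes [measurable]: "\<And>N. E N \<in> sets M"
    and cover: "\<And>\<epsilon>. 0 < \<epsilon> \<Longrightarrow> \<exists>F G. (\<forall>N. F N \<in> sets M \<and> G N \<in> sets M \<and> E N \<subseteq> F N \<union> G N) \<and>
      (\<lambda>N. prob (F N)) \<longlonglongrightarrow> 0 \<and> eventually (\<lambda>N. prob (G N) < \<epsilon>) sequentially"
  shows "(\<lambda>N. prob (E N)) \<longlonglongrightarrow> 0"
proof (rule order_tendstoI)
  fix a :: real assume "a < 0"
  then show "eventually (\<lambda>N. a < prob (E N)) sequentially"
    by (intro always_eventually allI) (rule less_le_trans[OF _ measure_nonneg])
next
  fix a :: real assume "0 < a"
  then obtain F G where FG: "\<And>N. F N \<in> sets M" "\<And>N. G N \<in> sets M" "\<And>N. E N \<subseteq> F N \<union> G N"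
    and F: "(\<lambda>N. prob (F N)) \<longlonglongrightarrow> 0" and G: "eventually (\<lambda>N. prob (G N) < a / 2) sequentially"
    using cover[of "a / 2"] by auto
  have "eventually (\<lambda>N. prob (F N) < a / 2) sequentially"
    using F by (rule order_tendstoD) (use \<open>0 < a\<close> in simp)
  then show "eventually (\<lambda>N. prob (E N) < a) sequentially"
    using G
  proof eventually_elim
    case (elim N)
    have "prob (E N) \<le> prob (F N \<union> G N)" using FG by (intro finite_measure_mono) auto
    also have "\<dots> \<le> prob (F N) + prob (G N)" using FG by (intro measure_Un_le)
    finally show ?case using elim by simp
  qed
qed

text \<open>If membership in the intersection changes under \<open>U\<close>, then membership in one
  of the two sets changes. This combines the event on the normalized sum with the event on the end
  point.\<close>

lemma asymptotically_invariant_Int: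
  assumes "prob_space M" and U [measurable]: "U \<in> measurable M M"
    and E: "asymptotically_invariant M U E" and F: "asymptotically_invariant M U F"
  shows "asymptotically_invariant M U (\<lambda>N. E N \<inter> F N)"
proof -
  interpret prob_space M by fact
  have [measurable]: "E N \<in> sets M" "F N \<in> sets M" for N
    using E F by (auto simp: asymptotically_invariant_def)
  let ?D = "\<lambda>E N. {x \<in> space M. (U x \<in> E N) \<noteq> (x \<in> E N)}"
  have "(\<lambda>N. prob (?D (\<lambda>N. E N \<inter> F N) N)) \<longlonglongrightarrow> 0"
  proof (rule measure_tendsto_0_if_small_cover)
    fix \<epsilon> :: real assume "0 < \<epsilon>"
    show "\<exists>G H. (\<forall>N. G N \<in> sets M \<and> H N \<in> sets M \<and> ?D (\<lambda>N. E N \<inter> F N) N \<subseteq> G N \<union> H N) \<and>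
        (\<lambda>N. prob (G N)) \<longlonglongrightarrow> 0 \<and> eventually (\<lambda>N. prob (H N) < \<epsilon>) sequentially"
      by (rule exI[of _ "?D E"], rule exI[of _ "?D F"])
        (use E F \<open>0 < \<epsilon>\<close> in \<open>auto simp: asymptotically_invariant_def intro: order_tendstoD(2)\<close>)
  qed measurable
  then show ?thesis by (simp add: asymptotically_invariant_def)
qed

section \<open>Interval events with non-atomic endpoints\<close>

text \<open>Open intervals around \<open>a\<close> shrink to the null set \<open>{a}\<close>. The
  endpoints are required to be null as well, because convergence in distribution is tested only on
  such intervals; this can be arranged since a law has at most countably many atoms.\<close>

lemma small_neighbourhood_of_non_atom:
  fixes S :: "'w \<Rightarrow> real"
  assumes "prob_space P" and S [measurable]: "S \<in> borel_measurable P"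
    and null: "measure P {\<omega> \<in> space P. S \<omega> = a} = 0" and "0 < \<epsilon>"
  obtains \<delta> where "0 < \<delta>" "measure P {\<omega> \<in> space P. S \<omega> \<in> {a - \<delta><..<a + \<delta>}} < \<epsilon>"
    "measure P {\<omega> \<in> space P. S \<omega> \<in> {a - \<delta>, a + \<delta>}} = 0"
proof -
  interpret prob_space P by fact
  define L where "L = distr P borel S"
  interpret L: prob_space L unfolding L_def by (rule prob_space_distr) measurable
  have L: "measure L X = prob {\<omega> \<in> space P. S \<omega> \<in> X}" if "X \<in> sets borel" for X
  proof -
    have "S -` X \<inter> space P = {\<omega> \<in> space P. S \<omega> \<in> X}" by auto
    then show ?thesis using that by (simp add: L_def measure_distr)
  qed
  have sL [measurable_cong, simp]: "sets L = sets borel" by (simp add: L_def)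
  define B where "B n = {a - 1 / real (Suc n)<..<a + 1 / real (Suc n)}" for n
  have "(\<lambda>n. measure L (B n)) \<longlonglongrightarrow> measure L (\<Inter>n. B n)"
  proof (rule L.finite_Lim_measure_decseq)
    show "decseq B"
      unfolding decseq_Suc_iff B_def
    proof (intro allI greaterThanLessThan_subseteq_greaterThanLessThan[THEN iffD2] impI conjI)
      fix n
      have "1 / real (Suc (Suc n)) \<le> 1 / real (Suc n)" by (simp add: frac_le)
      then show "a - 1 / real (Suc n) \<le> a - 1 / real (Suc (Suc n))"
        "a + 1 / real (Suc (Suc n)) \<le> a + 1 / real (Suc n)" by linarith+
    qed
  qed (auto simp: B_def)
  moreover have "(\<Inter>n. B n) = {a}"
  proof (intro equalityI subsetI)
    fix x assume x: "x \<in> (\<Inter>n. B n)"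
    show "x \<in> {a}"
    proof (rule ccontr)
      assume "x \<notin> {a}"
      then obtain n where "1 / real (Suc n) < \<bar>x - a\<bar>" using nat_approx_posE[of "\<bar>x - a\<bar>"] by auto
      moreover have "x \<in> B n" using x by blast
      ultimately show False unfolding B_def greaterThanLessThan_iff by linarith
    qed
  qed (auto simp: B_def)
  moreover have "measure L {a} = 0" using null by (simp add: L)
  ultimately have "(\<lambda>n. measure L (B n)) \<longlonglongrightarrow> 0" by simp
  then have "eventually (\<lambda>n. measure L (B n) < \<epsilon>) sequentially"
    using \<open>0 < \<epsilon>\<close> by (rule order_tendstoD)
  then obtain n where n: "measure L (B n) < \<epsilon>" by (auto simp: eventually_sequentially)
  \<comment> \<open>An unsuitable radius equals \<open>a - x\<close> or \<open>x - a\<close> for an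
    atom \<open>x\<close>. These are countably many, whereas the candidates form an uncountable
    interval.\<close>
  define Z where "Z = {x. measure L {x} \<noteq> 0}"
  have Z: "countable Z" unfolding Z_def by (rule L.countable_support)
  have "uncountable {0<..<1 / real (Suc n)}" by (simp add: uncountable_open_interval)
  moreover have "countable ((\<lambda>x. a - x) ` Z \<union> (\<lambda>x. x - a) ` Z)" using Z by simp
  ultimately obtain \<delta> where \<delta>: "\<delta> \<in> {0<..<1 / real (Suc n)}"
    "\<delta> \<notin> (\<lambda>x. a - x) ` Z" "\<delta> \<notin> (\<lambda>x. x - a) ` Z"
    by (meson UnCI countable_subset subsetI)
  have "a - \<delta> \<notin> Z" "a + \<delta> \<notin> Z"
    using \<delta>(2,3) by (auto simp: image_iff dest!: bspec)
  then have "measure L {a - \<delta>} = 0" "measure L {a + \<delta>} = 0" by (auto simp: Z_def)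
  moreover have "measure L ({a - \<delta>} \<union> {a + \<delta>}) \<le> measure L {a - \<delta>} + measure L {a + \<delta>}"
    by (rule measure_Un_le) auto
  ultimately have "measure L {a - \<delta>, a + \<delta>} = 0"
    using measure_nonneg[of L "{a - \<delta>, a + \<delta>}"] by (simp add: insert_commute)
  moreover have "measure L {a - \<delta><..<a + \<delta>} \<le> measure L (B n)"
    using \<delta>(1) by (intro L.finite_measure_mono) (auto simp: B_def)
  ultimately show ?thesis
    using \<delta>(1) n by (intro that[of \<delta>]) (auto simp: L)
qed

text \<open>If \<open>Y N\<close> is perturbed by less than \<open>\<delta>\<close>, membership in \<open>(a, b)\<close> changes only where \<open>Y N\<close> lies
  within \<open>\<delta>\<close> of an endpoint, which is unlikely since the endpoints are not atoms of the limit.\<close>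

lemma asymptotically_invariant_interval:
  fixes Y :: "nat \<Rightarrow> 'a \<Rightarrow> real" and S :: "'w \<Rightarrow> real"
  assumes M: "prob_space M" and P: "prob_space P"
    and [measurable]: "\<And>N. Y N \<in> borel_measurable M" and S [measurable]: "S \<in> borel_measurable P"
    and conv: "converges_in_distribution M Y P S"
    and U [measurable]: "U \<in> measurable M M"
    and close: "AE x in M. (\<lambda>N. Y N (U x) - Y N x) \<longlonglongrightarrow> 0"
    and null: "measure P {\<omega> \<in> space P. S \<omega> \<in> {a, b}} = 0"
  shows "asymptotically_invariant M U (\<lambda>N. {x \<in> space M. Y N x \<in> {a<..<b}})"
proof -
  interpret prob_space M by fact
  interpret P: prob_space P by fact
  let ?E = "\<lambda>N. {x \<in> space M. Y N x \<in> {a<..<b}}"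
  have small: "\<exists>\<delta>>0. eventually (\<lambda>N. prob {x \<in> space M. Y N x \<in> {c - \<delta><..<c + \<delta>}} < \<epsilon>) sequentially"
    if "c \<in> {a, b}" "0 < \<epsilon>" for c \<epsilon>
  proof -
    have "measure P {\<omega> \<in> space P. S \<omega> = c} \<le> measure P {\<omega> \<in> space P. S \<omega> \<in> {a, b}}"
      using that by (intro P.finite_measure_mono) auto
    then have "measure P {\<omega> \<in> space P. S \<omega> = c} = 0"
      using null measure_nonneg[of P "{\<omega> \<in> space P. S \<omega> = c}"] by linarith
    then obtain \<delta> where "0 < \<delta>" and \<delta>: "measure P {\<omega> \<in> space P. S \<omega> \<in> {c - \<delta><..<c + \<delta>}} < \<epsilon>"
      "measure P {\<omega> \<in> space P. S \<omega> \<in> {c - \<delta>, c + \<delta>}} = 0"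
      using small_neighbourhood_of_non_atom[OF P S _ \<open>0 < \<epsilon>\<close>] by blast
    have "(\<lambda>N. prob {x \<in> space M. Y N x \<in> {c - \<delta><..<c + \<delta>}})
        \<longlonglongrightarrow> measure P {\<omega> \<in> space P. S \<omega> \<in> {c - \<delta><..<c + \<delta>}}"
      using conv \<delta>(2) unfolding converges_in_distribution_def by blast
    from order_tendstoD(2)[OF this \<delta>(1)] show ?thesis using \<open>0 < \<delta>\<close> by blast
  qed
  have "(\<lambda>N. prob {x \<in> space M. (U x \<in> ?E N) \<noteq> (x \<in> ?E N)}) \<longlonglongrightarrow> 0"
  proof (rule measure_tendsto_0_if_small_cover)
    fix \<epsilon> :: real assume "0 < \<epsilon>"
    obtain d1 where d1: "0 < d1"
      "eventually (\<lambda>N. prob {x \<in> space M. Y N x \<in> {a - d1<..<a + d1}} < \<epsilon> / 2) sequentially"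
      using small[of a "\<epsilon> / 2"] \<open>0 < \<epsilon>\<close> by auto
    obtain d2 where d2: "0 < d2"
      "eventually (\<lambda>N. prob {x \<in> space M. Y N x \<in> {b - d2<..<b + d2}} < \<epsilon> / 2) sequentially"
      using small[of b "\<epsilon> / 2"] \<open>0 < \<epsilon>\<close> by auto
    let ?\<delta> = "min d1 d2"
    let ?F = "\<lambda>N. {x \<in> space M. ?\<delta> \<le> \<bar>Y N (U x) - Y N x\<bar>}"
    let ?G1 = "\<lambda>N. {x \<in> space M. Y N x \<in> {a - d1<..<a + d1}}"
    let ?G2 = "\<lambda>N. {x \<in> space M. Y N x \<in> {b - d2<..<b + d2}}"
    have "(\<lambda>N. prob (?F N)) \<longlonglongrightarrow> 0"
      using close d1(1) d2(1) by (intro tendsto_AE_imp_measure) auto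
    moreover have "eventually (\<lambda>N. prob (?G1 N \<union> ?G2 N) < \<epsilon>) sequentially"
      using d1(2) d2(2)
    proof eventually_elim
      case (elim N)
      have "prob (?G1 N \<union> ?G2 N) \<le> prob (?G1 N) + prob (?G2 N)"
        by (intro measure_Un_le) measurable
      then show ?case using elim by linarith
    qed
    moreover have "{x \<in> space M. (U x \<in> ?E N) \<noteq> (x \<in> ?E N)} \<subseteq> ?F N \<union> (?G1 N \<union> ?G2 N)" for N
    proof
      fix x assume x: "x \<in> {x \<in> space M. (U x \<in> ?E N) \<noteq> (x \<in> ?E N)}"
      then have "U x \<in> space M" using measurable_space[OF U] by simp
      then have "(a < Y N (U x) \<and> Y N (U x) < b) \<noteq> (a < Y N x \<and> Y N x < b)" using x by auto
      then have "min d1 d2 \<le> \<bar>Y N (U x) - Y N x\<bar> \<or> (a - d1 < Y N x \<and> Y N x < a + d1)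
          \<or> (b - d2 < Y N x \<and> Y N x < b + d2)"
        by linarith
      then show "x \<in> ?F N \<union> (?G1 N \<union> ?G2 N)" using x by simp
    qed
    moreover have "?F N \<in> sets M" "?G1 N \<union> ?G2 N \<in> sets M" for N by measurable
    ultimately show "\<exists>F G. (\<forall>N. F N \<in> sets M \<and> G N \<in> sets M \<and>
          {x \<in> space M. (U x \<in> ?E N) \<noteq> (x \<in> ?E N)} \<subseteq> F N \<union> G N) \<and>
        (\<lambda>N. prob (F N)) \<longlonglongrightarrow> 0 \<and> eventually (\<lambda>N. prob (G N) < \<epsilon>) sequentially"
      by - (rule exI[of _ ?F], rule exI[of _ "\<lambda>N. ?G1 N \<union> ?G2 N"], simp only: simp_thms)
  qed measurable
  then show ?thesis by (simp add: asymptotically_invariant_def)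
qed

section \<open>Hyperbolic pairs: invariance of iterated preimages and ergodicity\<close>

lemma hyperbolic_pair_dist_tendsto_0:
  assumes "hyperbolic_pair M T U"
  shows "AE x in M. (\<lambda>n. dist ((T ^^ n) (U x)) ((T ^^ n) x)) \<longlonglongrightarrow> 0"
  using assms unfolding hyperbolic_pair_def
proof eventually_elim
  case (elim x)
  then obtain C \<kappa> where "0 < \<kappa>"
    and le: "\<And>n::nat. dist ((T ^^ n) (U x)) ((T ^^ n) x) \<le> C * exp (- \<kappa> * real n)" by blast
  then have "(\<lambda>n::nat. exp (- \<kappa>) ^ n) \<longlonglongrightarrow> 0" by (intro LIMSEQ_realpow_zero) auto
  then have "(\<lambda>n::nat. C * exp (- \<kappa>) ^ n) \<longlonglongrightarrow> C * 0" by (rule tendsto_mult_left)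
  moreover have "exp (- \<kappa> * real n) = exp (- \<kappa>) ^ n" for n
    by (simp add: exp_of_nat_mult[symmetric] mult.commute)
  ultimately have "(\<lambda>n::nat. C * exp (- \<kappa> * real n)) \<longlonglongrightarrow> 0" by simp
  then show ?case by (rule Lim_null_comparison[rotated]) (use le in auto)
qed

text \<open>The boundary layer \<open>{0 < infdist \<cdot> C < \<delta>}\<close> of a closed set \<open>C\<close> has small measure, uniformly under
  the iterates of \<open>T\<close>; general Borel sets follow by a Dynkin argument. The distance itself is not used
  as a function of two variables, since it need not be measurable if the space is not separable.\<close>

lemma asymptotically_invariant_preimages:
  fixes M :: "'x::metric_space measure"
  assumes M: "prob_space M" and sets_M: "sets M = sets borel"
    and T: "measure_preserving M T" and U: "measure_preserving M U"
    and hyp: "hyperbolic_pair M T U" and B: "B \<in> sets borel"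
  shows "asymptotically_invariant M U (\<lambda>N. {x. (T ^^ N) x \<in> B})"
proof -
  interpret prob_space M by fact
  have sp [simp]: "space M = UNIV" using sets_eq_imp_space_eq[OF sets_M] by simp
  have mpT: "measure_preserving M (T ^^ n)" for n by (rule measure_preserving_funpow[OF T])
  then have Tn [measurable]: "T ^^ n \<in> measurable M M" for n by (simp add: measure_preserving_def)
  have Um [measurable]: "U \<in> measurable M M" using U by (simp add: measure_preserving_def)
  define D where "D B N = {x. ((T ^^ N) (U x) \<in> B) \<noteq> ((T ^^ N) x \<in> B)}" for B N
  have D_meas [measurable]: "D B N \<in> sets M" if [measurable]: "B \<in> sets M" for B N
  proof -
    have "{x \<in> space M. ((T ^^ N) (U x) \<in> B) \<noteq> ((T ^^ N) x \<in> B)} \<in> sets M" by measurable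
    then show ?thesis by (simp add: D_def)
  qed
  have pT: "prob {x. (T ^^ N) x \<in> B} = prob B" if "B \<in> sets M" for B N
    using measure_preserving_measure[OF mpT that] by simp
  have pTU: "prob {x. (T ^^ N) (U x) \<in> B} = prob B" if [measurable]: "B \<in> sets M" for B N
  proof -
    have "{x \<in> space M. (T ^^ N) x \<in> B} \<in> sets M" by measurable
    then show ?thesis
      using measure_preserving_measure[OF U, of "{x. (T ^^ N) x \<in> B}"] pT[OF that, of N] by simp
  qed
  have "(\<lambda>N. prob (D B N)) \<longlonglongrightarrow> 0"
  proof -
    have "Int_stable (Collect closed :: 'x set set)" "Collect closed \<subseteq> Pow (UNIV :: 'x set)"
      by (auto simp: Int_stable_def)
    moreover have "B \<in> sigma_sets UNIV (Collect closed)"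
      using B by (simp add: borel_eq_closed)
    ultimately show ?thesis
    proof (induction B rule: sigma_sets_induct_disjoint)
      case (basic C)
      then have C: "closed C" by simp
      show ?case
      \<comment> \<open>The empty set is treated separately: \<open>infdist\<close> to it is 0 by
        convention, so distance 0 would not characterize membership.\<close>
      proof (cases "C = {}")
        case False
        have iC: "infdist x C = 0 \<longleftrightarrow> x \<in> C" for x
          using in_closed_iff_infdist_zero[OF C False] by blast
        have "(\<lambda>x. infdist x C) \<in> borel_measurable borel"
          by (intro borel_measurable_continuous_onI continuous_intros)
        then have [measurable]: "(\<lambda>x. infdist x C) \<in> borel_measurable M"
          using measurable_cong_sets[OF sets_M] by blast
        show ?thesis
        proof (rule measure_tendsto_0_if_small_cover)
          show "D C N \<in> sets M" for N using C by (intro D_meas) (simp add: sets_M)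
          fix \<epsilon> :: real assume "0 < \<epsilon>"
          \<comment> \<open>The layer excludes \<open>C\<close> itself, so the sets
            \<open>L n\<close> decrease to the empty set and their measures tend to 0.\<close>
          define L where "L n = {x. 0 < infdist x C \<and> infdist x C < 1 / real (Suc n)}" for n
          have L_sets [measurable]: "L n \<in> sets M" for n
          proof -
            have "{x \<in> space M. 0 < infdist x C \<and> infdist x C < 1 / real (Suc n)} \<in> sets M" by measurable
            then show ?thesis by (simp add: L_def)
          qed
          have "(\<lambda>n. prob (L n)) \<longlonglongrightarrow> prob (\<Inter>n. L n)"
          proof (rule finite_Lim_measure_decseq)
            show "decseq L"
              unfolding decseq_Suc_iff
            proof
              fix n
              have "1 / real (Suc (Suc n)) \<le> 1 / real (Suc n)" by (simp add: frac_le)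
              then show "L (Suc n) \<subseteq> L n" unfolding L_def by (auto simp del: of_nat_Suc)
            qed
          qed auto
          moreover have "(\<Inter>n. L n) = {}"
          proof -
            have False if x: "\<And>n. x \<in> L n" for x
            proof -
              obtain n where "1 / real (Suc n) < infdist x C"
                using nat_approx_posE[of "infdist x C"] x[of 0] by (auto simp: L_def)
              then show False using x[of n] by (simp add: L_def)
            qed
            then show ?thesis by blast
          qed
          ultimately have "(\<lambda>n. prob (L n)) \<longlonglongrightarrow> 0" by simp
          then have "eventually (\<lambda>n. prob (L n) < \<epsilon> / 2) sequentially"
            using \<open>0 < \<epsilon>\<close> by (intro order_tendstoD(2)[of _ 0]) auto
          then obtain n where n: "prob (L n) < \<epsilon> / 2" by (auto simp: eventually_sequentially)
          let ?F = "\<lambda>N. {x. 1 / real (Suc n) \<le> \<bar>infdist ((T ^^ N) (U x)) C - infdist ((T ^^ N) x) C\<bar>}"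
          let ?G = "\<lambda>N. {x. (T ^^ N) x \<in> L n} \<union> {x. (T ^^ N) (U x) \<in> L n}"
          have "(\<lambda>N. prob {x \<in> space M. 1 / real (Suc n) \<le>
              \<bar>infdist ((T ^^ N) (U x)) C - infdist ((T ^^ N) x) C\<bar>}) \<longlonglongrightarrow> 0"
          proof (rule tendsto_AE_imp_measure)
            \<comment> \<open>The distance to \<open>C\<close> is 1-Lipschitz, so the difference is
              bounded by the distance of the two orbit points.\<close>
            show "AE x in M. (\<lambda>N. infdist ((T ^^ N) (U x)) C - infdist ((T ^^ N) x) C) \<longlonglongrightarrow> 0"
              using hyperbolic_pair_dist_tendsto_0[OF hyp]
            proof eventually_elim
              case (elim x)
              then show ?case
                by (rule Lim_null_comparison[rotated])
                  (simp add: infdist_triangle_abs)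
            qed
          qed auto
          moreover have G: "{x. (T ^^ N) x \<in> L n} \<in> sets M" "{x. (T ^^ N) (U x) \<in> L n} \<in> sets M" for N
          proof -
            have "{x \<in> space M. (T ^^ N) x \<in> L n} \<in> sets M"
              "{x \<in> space M. (T ^^ N) (U x) \<in> L n} \<in> sets M" by measurable
            then show "{x. (T ^^ N) x \<in> L n} \<in> sets M" "{x. (T ^^ N) (U x) \<in> L n} \<in> sets M"
              by simp_all
          qed
          \<comment> \<open>Both \<open>T ^^ N\<close> and \<open>U\<close> preserve the measure, so
            each half of \<open>?G N\<close> has the measure of \<open>L n\<close>, for every
            \<open>N\<close> at once.\<close>
          moreover have "prob (?G N) < \<epsilon>" for N
            using measure_Un_le[OF G[of N]] n pT[OF L_sets] pTU[OF L_sets] by simp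
          moreover have "?F N \<in> sets M" for N
          proof -
            have "{x \<in> space M. 1 / real (Suc n) \<le>
                \<bar>infdist ((T ^^ N) (U x)) C - infdist ((T ^^ N) x) C\<bar>} \<in> sets M" by measurable
            then show ?thesis by simp
          qed
          moreover have "D C N \<subseteq> ?F N \<union> ?G N" for N
          proof
            \<comment> \<open>If exactly one of the two points lies in \<open>C\<close>, the other
              has positive distance to \<open>C\<close>. Either it lies in the layer, or the two
              distances differ by at least \<open>1 / (n + 1)\<close>.\<close>
            fix x assume "x \<in> D C N"
            then have "(infdist ((T ^^ N) (U x)) C = 0) \<noteq> (infdist ((T ^^ N) x) C = 0)"
              by (simp add: D_def iC)
            moreover have "0 \<le> infdist ((T ^^ N) (U x)) C" "0 \<le> infdist ((T ^^ N) x) C"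
              by (simp_all add: infdist_nonneg)
            ultimately show "x \<in> ?F N \<union> ?G N"
              unfolding Un_iff mem_Collect_eq L_def by linarith
          qed
          ultimately show "\<exists>F G. (\<forall>N. F N \<in> sets M \<and> G N \<in> sets M \<and> D C N \<subseteq> F N \<union> G N) \<and>
              (\<lambda>N. prob (F N)) \<longlonglongrightarrow> 0 \<and> eventually (\<lambda>N. prob (G N) < \<epsilon>) sequentially"
            by (intro exI[of _ ?F] exI[of _ ?G]) auto
        qed
      qed (simp add: D_def)
    next
      case empty
      then show ?case by (simp add: D_def)
    next
      case (compl A)
      \<comment> \<open>Complementing reverses both memberships, so the set where they differ stays
        the same.\<close>
      have "D (UNIV - A) = D A" by (auto simp: D_def fun_eq_iff)
      then show ?case using compl by simp
    next
      case (union A)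
      have A [measurable]: "A i \<in> sets M" for i
        using union(2) by (auto simp: sets_M borel_eq_closed)
      show ?case
      proof (rule measure_tendsto_0_if_small_cover)
        show "D (\<Union>i. A i) N \<in> sets M" for N by measurable
        fix \<epsilon> :: real assume "0 < \<epsilon>"
        \<comment> \<open>The tails \<open>R n\<close> decrease to the empty set, so some tail is
          small; the induction hypothesis handles the finitely many sets before it.\<close>
        define R where "R n = (\<Union>i. A i) - (\<Union>i<n. A i)" for n
        have R_sets [measurable]: "R n \<in> sets M" for n unfolding R_def by measurable
        have "(\<lambda>n. prob (R n)) \<longlonglongrightarrow> prob (\<Inter>n. R n)"
        proof (rule finite_Lim_measure_decseq)
          show "decseq R" unfolding decseq_Suc_iff R_def by (auto simp: lessThan_Suc)
        qed auto
        moreover have "(\<Inter>n. R n) = {}"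
        proof -
          have False if x: "\<And>n. x \<in> R n" for x
          proof -
            obtain i where "x \<in> A i" using x[of 0] by (auto simp: R_def)
            then show False using x[of "Suc i"] by (auto simp: R_def)
          qed
          then show ?thesis by blast
        qed
        ultimately have "(\<lambda>n. prob (R n)) \<longlonglongrightarrow> 0" by simp
        then have "eventually (\<lambda>n. prob (R n) < \<epsilon> / 2) sequentially"
          using \<open>0 < \<epsilon>\<close> by (intro order_tendstoD(2)[of _ 0]) auto
        then obtain n where n: "prob (R n) < \<epsilon> / 2" by (auto simp: eventually_sequentially)
        let ?F = "\<lambda>N. \<Union>i<n. D (A i) N"
        let ?G = "\<lambda>N. {x. (T ^^ N) x \<in> R n} \<union> {x. (T ^^ N) (U x) \<in> R n}"
        have "(\<lambda>N. prob (?F N)) \<longlonglongrightarrow> 0"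
        proof (rule tendsto_sandwich[of "\<lambda>_. 0"])
          show "eventually (\<lambda>N. prob (?F N) \<le> (\<Sum>i<n. prob (D (A i) N))) sequentially"
            by (intro always_eventually allI measure_UNION_le) auto
          show "(\<lambda>N. \<Sum>i<n. prob (D (A i) N)) \<longlonglongrightarrow> 0"
            using union(3) by (intro tendsto_null_sum) auto
        qed auto
        moreover have G: "{x. (T ^^ N) x \<in> R n} \<in> sets M" "{x. (T ^^ N) (U x) \<in> R n} \<in> sets M" for N
        proof -
          have "{x \<in> space M. (T ^^ N) x \<in> R n} \<in> sets M"
            "{x \<in> space M. (T ^^ N) (U x) \<in> R n} \<in> sets M" by measurable
          then show "{x. (T ^^ N) x \<in> R n} \<in> sets M" "{x. (T ^^ N) (U x) \<in> R n} \<in> sets M"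
            by simp_all
        qed
        moreover have "prob (?G N) < \<epsilon>" for N
          using measure_Un_le[OF G[of N]] n pT[OF R_sets] pTU[OF R_sets] by simp
        moreover have "?F N \<in> sets M" for N by measurable
        moreover have "D (\<Union>i. A i) N \<subseteq> ?F N \<union> ?G N" for N
          by (auto simp: D_def R_def)
        ultimately show "\<exists>F G. (\<forall>N. F N \<in> sets M \<and> G N \<in> sets M \<and> D (\<Union>i. A i) N \<subseteq> F N \<union> G N) \<and>
            (\<lambda>N. prob (F N)) \<longlonglongrightarrow> 0 \<and> eventually (\<lambda>N. prob (G N) < \<epsilon>) sequentially"
          by (intro exI[of _ ?F] exI[of _ ?G]) auto
      qed
    qed
  qed
  moreover have "{x. (T ^^ N) x \<in> B} \<in> sets M" for N
  proof -
    have "{x \<in> space M. (T ^^ N) x \<in> B} \<in> sets M" using B unfolding sets_M[symmetric] by measurable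
    then show ?thesis by simp
  qed
  ultimately show ?thesis by (simp add: asymptotically_invariant_def D_def)
qed

text \<open>For a \<open>T\<close>-invariant set \<open>A\<close> all preimages under
  \<open>T ^^ N\<close> equal \<open>A\<close>, so the constant sequence \<open>A\<close> is
  asymptotically \<open>U\<close>-invariant. Decorrelating it from \<open>A\<close> itself shows
  that \<open>prob A\<close> equals its own square.\<close>

lemma hyperbolic_pair_imp_ergodic:
  fixes M :: "'x::metric_space measure"
  assumes M: "prob_space M" and sets_M: "sets M = sets borel"
    and T: "measure_preserving M T" and U: "ergodic M U" and hyp: "hyperbolic_pair M T U"
  shows "ergodic M T"
  unfolding ergodic_def
proof (intro conjI ballI impI T)
  interpret prob_space M by fact
  have sp [simp]: "space M = UNIV" using sets_eq_imp_space_eq[OF sets_M] by simp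
  fix A assume A: "A \<in> sets M" and inv: "T -` A \<inter> space M = A"
  then have "T x \<in> A \<longleftrightarrow> x \<in> A" for x by auto
  then have "(T ^^ N) x \<in> A \<longleftrightarrow> x \<in> A" for N x by (induction N) auto
  then have "asymptotically_invariant M U (\<lambda>N. A)"
    using asymptotically_invariant_preimages[OF M sets_M T _ hyp, of A] U A sets_M
    by (simp add: ergodic_def)
  then have "(\<lambda>N::nat. prob (A \<inter> A) - prob A * prob A) \<longlonglongrightarrow> 0"
    using asymptotically_invariant_decorrelates[OF M U] A by blast
  then have "prob A - prob A * prob A = 0" by (simp add: LIMSEQ_const_iff)
  then have "prob A * (1 - prob A) = 0" by (simp add: algebra_simps)
  then show "prob A = 0 \<or> prob A = 1" by simp
qed

section \<open>Decorrelation from iterated preimages\<close>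

text \<open>The sets \<open>T\<^sup>N (E N)\<close> have the same defect of \<open>T\<close>-invariance as \<open>E N\<close>, so they decorrelate
  from the fixed set \<open>B\<close>; pulling back by \<open>T\<^sup>N\<close> gives the claim.\<close>

lemma asymptotically_invariant_decorrelates_from_preimages:
  assumes M: "prob_space M" and sp: "space M = UNIV" and erg: "ergodic M T"
    and inver: "invertible_transformation M T"
    and inv: "asymptotically_invariant M T E" and B: "B \<in> sets M"
  shows "(\<lambda>N. measure M (E N \<inter> {x. (T ^^ N) x \<in> B}) - measure M (E N) * measure M B) \<longlonglongrightarrow> 0"
proof -
  interpret prob_space M by fact
  have T: "measure_preserving M T" using erg by (simp add: ergodic_def)
  have mpT: "measure_preserving M (T ^^ n)" for n by (rule measure_preserving_funpow[OF T])
  have [measurable]: "T \<in> measurable M M" using T by (simp add: measure_preserving_def)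
  have E: "E N \<in> sets M" for N using inv by (auto simp: asymptotically_invariant_def)
  have bij: "bij T" and Ti: "the_inv T \<in> measurable M M"
    using inver sp by (auto simp: invertible_transformation_def)
  have inj: "inj (T ^^ N)" for N using bij by (simp add: bij_betw_def bij_betw_funpow inj_fn)
  \<comment> \<open>Forward images are measurable as preimages under the measurable inverse of
    \<open>T\<close>, applied once per iteration.\<close>
  have image: "(T ^^ N) ` X \<in> sets M" if "X \<in> sets M" for X N
  proof (induction N)
    case (Suc N)
    have "(T ^^ Suc N) ` X = the_inv T -` ((T ^^ N) ` X)"
    proof (intro equalityI subsetI)
      fix y assume "y \<in> (T ^^ Suc N) ` X"
      then show "y \<in> the_inv T -` ((T ^^ N) ` X)"
        using bij by (auto simp: bij_def the_inv_f_f)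
    next
      fix y assume "y \<in> the_inv T -` ((T ^^ N) ` X)"
      then obtain x where "x \<in> X" "the_inv T y = (T ^^ N) x" by auto
      moreover have "T (the_inv T y) = y" using bij by (simp add: f_the_inv_into_f_bij_betw)
      ultimately show "y \<in> (T ^^ Suc N) ` X" by (auto intro!: image_eqI[of _ _ x])
    qed
    then show ?case using measurable_sets[OF Ti Suc] sp by simp
  qed (use that in simp)
  define H where "H N = (T ^^ N) ` E N" for N
  have H [measurable]: "H N \<in> sets M" for N unfolding H_def by (rule image[OF E])
  have H_iff: "(T ^^ N) x \<in> H N \<longleftrightarrow> x \<in> E N" for N x
    unfolding H_def using inj by (rule inj_image_mem_iff)
  have "asymptotically_invariant M T H"
  proof -
    \<comment> \<open>The defect sets of \<open>H N\<close> and \<open>E N\<close> correspond under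
      \<open>T ^^ N\<close>, which commutes with \<open>T\<close> and preserves the measure.\<close>
    have "prob {x \<in> space M. (T x \<in> H N) \<noteq> (x \<in> H N)}
        = prob {x \<in> space M. (T x \<in> E N) \<noteq> (x \<in> E N)}" for N
    proof -
      have "prob {x \<in> space M. (T ^^ N) x \<in> {x \<in> space M. (T x \<in> H N) \<noteq> (x \<in> H N)}}
          = prob {x \<in> space M. (T x \<in> H N) \<noteq> (x \<in> H N)}"
        by (rule measure_preserving_measure[OF mpT]) measurable
      moreover have "T ((T ^^ N) x) \<in> H N \<longleftrightarrow> T x \<in> E N" for x
        using H_iff[of N "T x"] by (simp add: funpow_swap1)
      ultimately show ?thesis by (simp add: sp H_iff)
    qed
    then show ?thesis using inv H by (simp add: asymptotically_invariant_def)
  qed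
  from asymptotically_invariant_decorrelates[OF M erg this B]
  have "(\<lambda>N. prob (B \<inter> H N) - prob B * prob (H N)) \<longlonglongrightarrow> 0" .
  moreover have "prob (H N) = prob (E N)" "prob (B \<inter> H N) = prob (E N \<inter> {x. (T ^^ N) x \<in> B})" for N
    using measure_preserving_measure[OF mpT H, of N N]
      measure_preserving_measure[OF mpT sets.Int[OF B H], of N N]
    by (simp_all add: sp H_iff Int_def conj_commute)
  ultimately show ?thesis by (simp add: mult.commute)
qed

section \<open>Almost invariance of normalized sums\<close>

lemma normalized_sum_diff:
  "normalized_sum T f A V N y - normalized_sum T f A V N x
     = (\<Sum>n<N. f ((T ^^ n) y) - f ((T ^^ n) x)) / V N"
  by (simp add: normalized_sum_def diff_divide_distrib[symmetric] sum_subtractf)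

text \<open>The centring cancels in the difference, and the triangle inequality bounds the rest by
  the quotient in \<open>adapted\<close>.\<close>

lemma normalized_sum_adapted:
  assumes "adapted M T U V f" and V: "\<And>N. V N > 0"
  shows "AE x in M. (\<lambda>N. normalized_sum T f A V N (U x) - normalized_sum T f A V N x) \<longlonglongrightarrow> 0"
  using assms(1) unfolding adapted_def
proof eventually_elim
  case (elim x)
  show ?case
  proof (rule Lim_null_comparison[OF _ elim], rule always_eventually, rule allI)
    fix N
    let ?d = "\<lambda>n. f ((T ^^ n) (U x)) - f ((T ^^ n) x)"
    have "\<bar>\<Sum>n<N. ?d n\<bar> \<le> (\<Sum>n<N. \<bar>?d n\<bar>)" by (rule sum_abs)
    \<comment> \<open>The sum in \<open>adapted\<close> includes the index \<open>N\<close>, one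
      more than the normalized sum; the extra term is nonnegative.\<close>
    also have "\<dots> \<le> (\<Sum>n=0..N. \<bar>?d n\<bar>)" by (rule sum_mono2) auto
    finally show "norm (normalized_sum T f A V N (U x) - normalized_sum T f A V N x)
        \<le> (\<Sum>n=0..N. \<bar>?d n\<bar>) / V N"
      using V[of N] by (simp add: normalized_sum_diff abs_divide divide_right_mono)
  qed
qed

text \<open>The difference telescopes to two boundary terms, which are bounded, while the divisor
  \<open>V N\<close> tends to infinity.\<close>

lemma normalized_sum_shift:
  assumes "bounded (range f)" and V: "filterlim V at_top sequentially"
  shows "(\<lambda>N. normalized_sum T f A V N (T x) - normalized_sum T f A V N x) \<longlonglongrightarrow> 0"
proof -
  obtain K where K: "\<And>x. \<bar>f x\<bar> \<le> K" using assms(1) by (auto simp: bounded_iff)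
  have "(\<Sum>n<N. f ((T ^^ n) (T x)) - f ((T ^^ n) x)) = f ((T ^^ N) x) - f x" for N
    by (induction N) (auto simp: funpow_swap1)
  then have eq: "normalized_sum T f A V N (T x) - normalized_sum T f A V N x
      = (f ((T ^^ N) x) - f x) / V N" for N
    by (simp add: normalized_sum_diff)
  have "(\<lambda>N. 2 * K / V N) \<longlonglongrightarrow> 0" by (rule tendsto_divide_0[OF tendsto_const filterlim_at_top_imp_at_infinity[OF V]])
  then show ?thesis
  proof (rule Lim_null_comparison[rotated])
    have "eventually (\<lambda>N. 0 < V N) sequentially"
      using V by (simp add: filterlim_at_top_dense)
    then show "eventually (\<lambda>N. norm (normalized_sum T f A V N (T x) - normalized_sum T f A V N x)
        \<le> 2 * K / V N) sequentially"
    proof eventually_elim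
      case (elim N)
      have "\<bar>f ((T ^^ N) x) - f x\<bar> \<le> 2 * K" using K[of "(T ^^ N) x"] K[of x] by linarith
      then show ?case using elim by (simp add: eq abs_divide divide_right_mono)
    qed
  qed
qed

section \<open>Asymptotic independence of initial point, normalized sum and end point\<close>

theorem theorem1p4:
  fixes M :: "'x::metric_space measure"
    and T :: "'x \<Rightarrow> 'x"
    and f :: "'x \<Rightarrow> real"
    and cent V :: "nat \<Rightarrow> real"
    and P :: "'w measure"
    and S :: "'w \<Rightarrow> real"
  assumes "prob_space M" and "sets M = sets borel"
    and "invertible_transformation M T" and "measure_preserving M T"
    and "f \<in> borel_measurable M" and "bounded (range f)"
    and "\<And>N. V N > 0" and "filterlim V at_top sequentially"
    and "prob_space P" and "S \<in> borel_measurable P"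
    and "converges_in_distribution M (normalized_sum T f cent V) P S"
    and "\<exists>U. ergodic M U \<and> hyperbolic_pair M T U \<and> adapted M T U V f"
  shows "\<forall>A\<in>sets borel. \<forall>B\<in>sets borel. \<forall>a b.
    measure P {\<omega> \<in> space P. S \<omega> \<in> {a, b}} = 0 \<longrightarrow>
      (\<lambda>N. measure M {x. x \<in> A \<and> normalized_sum T f cent V N x \<in> {a<..<b} \<and> (T ^^ N) x \<in> B})
        \<longlonglongrightarrow> measure M A * measure P {\<omega> \<in> space P. S \<omega> \<in> {a<..<b}} * measure M B"
proof (intro ballI allI impI)
  fix A B :: "'x set" and a b :: real
  assume A: "A \<in> sets borel" and B: "B \<in> sets borel"
    and null: "measure P {\<omega> \<in> space P. S \<omega> \<in> {a, b}} = 0"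
  interpret prob_space M by fact
  note M = assms(1) and sets_M = assms(2)
  have sp [simp]: "space M = UNIV" using sets_eq_imp_space_eq[OF sets_M] by simp
  obtain U where U: "ergodic M U" and hyp: "hyperbolic_pair M T U" and ad: "adapted M T U V f"
    using assms(12) by blast
  have mpU: "measure_preserving M U" and U_meas: "U \<in> measurable M M"
    using U by (auto simp: ergodic_def measure_preserving_def)
  have T_meas [measurable]: "T ^^ n \<in> measurable M M" for n
    using measure_preserving_funpow[OF assms(4)] by (simp add: measure_preserving_def)
  have T1: "T \<in> measurable M M" using assms(4) by (simp add: measure_preserving_def)
  note assms(5) [measurable]
  have S_meas: "normalized_sum T f cent V N \<in> borel_measurable M" for N
    unfolding normalized_sum_def[abs_def] by measurable
  define I where "I N = {x. normalized_sum T f cent V N x \<in> {a<..<b}}" for N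
  define p where "p = measure P {\<omega> \<in> space P. S \<omega> \<in> {a<..<b}}"
  define E where "E N = I N \<inter> {x. (T ^^ N) x \<in> B}" for N
  have erg_T: "ergodic M T"
    by (rule hyperbolic_pair_imp_ergodic[OF M sets_M assms(4) U hyp])
  \<comment> \<open>This is applied with \<open>W = U\<close> to split off \<open>A\<close> and with
    \<open>W = T\<close> to split off \<open>B\<close>.\<close>
  have I_inv: "asymptotically_invariant M W I"
    if "W \<in> measurable M M"
      "AE x in M. (\<lambda>N. normalized_sum T f cent V N (W x) - normalized_sum T f cent V N x) \<longlonglongrightarrow> 0" for W
    using asymptotically_invariant_interval[OF M assms(9) S_meas assms(10,11) that null]
    by (simp add: I_def[abs_def])
  have "asymptotically_invariant M U E"
    unfolding E_def
    by (intro asymptotically_invariant_Int M U_meas I_inv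
        normalized_sum_adapted[OF ad assms(7)]
        asymptotically_invariant_preimages[OF M sets_M assms(4) mpU hyp B])
  then have "(\<lambda>N. prob (A \<inter> E N) - prob A * prob (E N)) \<longlonglongrightarrow> 0"
    using A sets_M by (intro asymptotically_invariant_decorrelates[OF M U]) auto
  moreover have "(\<lambda>N. prob (E N) - prob (I N) * prob B) \<longlonglongrightarrow> 0"
    unfolding E_def
    by (rule asymptotically_invariant_decorrelates_from_preimages[OF M sp erg_T assms(3)])
      (use I_inv[OF T1] normalized_sum_shift[OF assms(6,8)] B sets_M in auto)
  moreover have "(\<lambda>N. prob (I N)) \<longlonglongrightarrow> p"
    using assms(11) null by (simp add: converges_in_distribution_def I_def p_def)
  \<comment> \<open>The sum rewrites \<open>prob (A \<inter> E N)\<close> as the error of splitting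
    off \<open>A\<close>, plus \<open>prob A\<close> times the error of splitting off
    \<open>B\<close>, plus the main term.\<close>
  ultimately have "(\<lambda>N. (prob (A \<inter> E N) - prob A * prob (E N))
      + prob A * (prob (E N) - prob (I N) * prob B) + prob A * (prob (I N) * prob B))
      \<longlonglongrightarrow> 0 + prob A * 0 + prob A * (p * prob B)"
    by (intro tendsto_intros)
  moreover have "{x. x \<in> A \<and> normalized_sum T f cent V N x \<in> {a<..<b} \<and> (T ^^ N) x \<in> B} = A \<inter> E N" for N
    by (auto simp: E_def I_def)
  ultimately show "(\<lambda>N. prob {x. x \<in> A \<and> normalized_sum T f cent V N x \<in> {a<..<b} \<and> (T ^^ N) x \<in> B})
      \<longlonglongrightarrow> prob A * measure P {\<omega> \<in> space P. S \<omega> \<in> {a<..<b}} * prob B"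
    by (simp add: p_def algebra_simps)
qed

end
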